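(* There is an absolute constant $c>0$ such that the following holds. Let $n$ be a power of $2$ and let $f:[n]^d\to\{0,1\}$ be $\varepsilon$-far from being monotone. Let $r$ be the minimum, over all maximal matchings $M$ in the violation graph of $f$, of the average distance $\frac{1}{|M|}\sum_{(x,y)\in M} d_{\mathbf{A}}(x,y)$. Then $I^-_f\ge c\, r\,\varepsilon$.
   Context: $[n]^d$ is partially ordered coordinatewise ($x\prec y$ iff $x\preceq y$ and $x\neq y$); $f$ is monotone if $f(x)\le f(y)$ whenever $x\preceq y$, and $\varepsilon$-far from monotone if it differs from every monotone function on at least $\varepsilon n^d$ points. The violation graph of $f$ has an edge (violated pair) $(x,y)$ whenever $x\prec y$, $f(x)=1$, $f(y)=0$; a matching is a set of vertex-disjoint violated pairs, maximal with respect to inclusion. The augmented hypergrid $\mathbf{A}_{n,d}$ is the directed graph on $[n]^d$ with an edge $(x,y)$ whenever $x,y$ differ in exactly one coordinate $i$ and $y_i-x_i=2^a$ for some integer $a\ge0$; $d_{\mathbf{A}}(x,y)$ is the directed shortest-path distance in $\mathbf{A}_{n,d}$. $S^-_f$ is the set of edges $(x,y)$ of $\mathbf{A}_{n,d}$ with $f(x)=1,f(y)=0$, and $I^-_f:=|S^-_f|/n^d$. *)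

theory Defs
  imports Complex_Main "HOL-Library.FuncSet"
begin

text \<open>
  Points of $[n]^d$ are extensional functions, equal to \<^term>\<open>undefined\<close> off \<^term>\<open>{1..d}\<close>.
  Hence on \<open>hypergrid n d\<close> the pointwise order of functions is the coordinatewise order
  and \<open><\<close> is its strict part.
\<close>

definition hypergrid :: "nat \<Rightarrow> nat \<Rightarrow> (nat \<Rightarrow> nat) set" where
  "hypergrid n d = ({1..d} \<rightarrow>\<^sub>E {1..n})"

definition eps_far_from_monotone ::
    "nat \<Rightarrow> nat \<Rightarrow> real \<Rightarrow> ((nat \<Rightarrow> nat) \<Rightarrow> nat) \<Rightarrow> bool" where
  "eps_far_from_monotone n d \<epsilon> f \<longleftrightarrow>
     (\<forall>g \<in> hypergrid n d \<rightarrow> {0, 1}. mono_on (hypergrid n d) g \<longrightarrow>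
        real (card {x \<in> hypergrid n d. f x \<noteq> g x}) \<ge> \<epsilon> * real n ^ d)"

definition violated_pairs ::
    "nat \<Rightarrow> nat \<Rightarrow> ((nat \<Rightarrow> nat) \<Rightarrow> nat) \<Rightarrow> ((nat \<Rightarrow> nat) \<times> (nat \<Rightarrow> nat)) set" where
  "violated_pairs n d f =
     {(x, y). x \<in> hypergrid n d \<and> y \<in> hypergrid n d \<and> x < y \<and> f x = 1 \<and> f y = 0}"

definition violation_matching ::
    "nat \<Rightarrow> nat \<Rightarrow> ((nat \<Rightarrow> nat) \<Rightarrow> nat) \<Rightarrow> ((nat \<Rightarrow> nat) \<times> (nat \<Rightarrow> nat)) set \<Rightarrow> bool" where
  "violation_matching n d f M \<longleftrightarrow>
     M \<subseteq> violated_pairs n d f \<and>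
     (\<forall>(x, y) \<in> M. \<forall>(x', y') \<in> M. (x, y) \<noteq> (x', y') \<longrightarrow> {x, y} \<inter> {x', y'} = {})"

definition maximal_violation_matching ::
    "nat \<Rightarrow> nat \<Rightarrow> ((nat \<Rightarrow> nat) \<Rightarrow> nat) \<Rightarrow> ((nat \<Rightarrow> nat) \<times> (nat \<Rightarrow> nat)) set \<Rightarrow> bool" where
  "maximal_violation_matching n d f M \<longleftrightarrow>
     violation_matching n d f M \<and>
     (\<forall>M'. violation_matching n d f M' \<and> M \<subseteq> M' \<longrightarrow> M' = M)"

definition augmented_edges :: "nat \<Rightarrow> nat \<Rightarrow> ((nat \<Rightarrow> nat) \<times> (nat \<Rightarrow> nat)) set" where
  "augmented_edges n d =
     {(x, y). x \<in> hypergrid n d \<and> y \<in> hypergrid n d \<and>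
        (\<exists>i a. {j \<in> {1..d}. x j \<noteq> y j} = {i} \<and> int (y i) - int (x i) = 2 ^ a)}"

text \<open>
  The relational power \<open>E ^^ k\<close> relates the endpoints of directed walks of length \<open>k\<close>, and a
  shortest walk is a shortest path.  The value is only meaningful when \<open>y\<close> is reachable from
  \<open>x\<close>; on the hypergrid this holds whenever \<open>x \<le> y\<close>, in particular for violated pairs.
\<close>

definition augmented_dist :: "nat \<Rightarrow> nat \<Rightarrow> (nat \<Rightarrow> nat) \<Rightarrow> (nat \<Rightarrow> nat) \<Rightarrow> nat" where
  "augmented_dist n d x y = (LEAST k. (x, y) \<in> augmented_edges n d ^^ k)"

definition average_dist ::
    "nat \<Rightarrow> nat \<Rightarrow> ((nat \<Rightarrow> nat) \<times> (nat \<Rightarrow> nat)) set \<Rightarrow> real" where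
  "average_dist n d M = (\<Sum>(x, y) \<in> M. real (augmented_dist n d x y)) / real (card M)"

text \<open>
  The minimum is over a finite nonempty set.  If \<open>f\<close> is not monotone on the grid, every maximal
  matching is nonempty, so the averages are genuine.
\<close>

definition min_average_dist :: "nat \<Rightarrow> nat \<Rightarrow> ((nat \<Rightarrow> nat) \<Rightarrow> nat) \<Rightarrow> real" where
  "min_average_dist n d f = Min (average_dist n d ` {M. maximal_violation_matching n d f M})"

definition negative_edges ::
    "nat \<Rightarrow> nat \<Rightarrow> ((nat \<Rightarrow> nat) \<Rightarrow> nat) \<Rightarrow> ((nat \<Rightarrow> nat) \<times> (nat \<Rightarrow> nat)) set" where
  "negative_edges n d f = {(x, y) \<in> augmented_edges n d. f x = 1 \<and> f y = 0}"

definition negative_influence :: "nat \<Rightarrow> nat \<Rightarrow> ((nat \<Rightarrow> nat) \<Rightarrow> nat) \<Rightarrow> real" where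
  "negative_influence n d f = real (card (negative_edges n d f)) / real n ^ d"

end

theory Submission
  imports Defs
begin

text \<open>
  Replace the distance by \<open>b(x, y) = (\<Sum>i. popcount (y i - x i))\<close>, which dominates the augmented
  distance, and let \<open>M\<close> be a matching of the violation graph of maximal total weight, where a pair
  has weight \<open>K - b(x, y) > 0\<close> for a large constant \<open>K\<close>; then \<open>M\<close> is inclusion-maximal. Bipartite
  linear programming duality provides potentials \<open>\<alpha>, \<beta> \<ge> 0\<close> with \<open>\<alpha> x + \<beta> y \<ge> K - b(x, y)\<close> on
  violated pairs, tight on \<open>M\<close> and vanishing at unmatched points.

  Fix a coordinate \<open>i\<close> and a bit \<open>a\<close>, and write \<open>s\<close> for the shift by \<open>2 ^ a\<close> in direction \<open>i\<close>. If bit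
  \<open>a\<close> of \<open>y i - x i\<close> is set for \<open>(x, y) \<in> M\<close>, then either \<open>(x, s x)\<close> is a negative edge or
  \<open>\<alpha> (s x) > \<alpha> x\<close>, since \<open>b(s x, y) < b(x, y)\<close>. An increment of \<open>\<alpha>\<close> across an edge is passed on by
  \<open>M\<close> to a decrement of \<open>\<beta>\<close> across another one, and vice versa, because \<open>b\<close> is shift invariant; this
  stops only at negative edges, and it never returns to a pair with bit \<open>a\<close> set, because adding
  \<open>2 ^ a\<close> to such a difference causes a carry and so does not increase its popcount. Counting
  gives at most two such pairs per negative edge in direction \<open>(i, a)\<close>. Summing over \<open>i\<close> and \<open>a\<close>
  bounds the total distance of \<open>M\<close> by \<open>2 |S|\<close> for the set \<open>S\<close> of negative edges, while
  \<open>|M| \<ge> \<epsilon> n ^ d / 2\<close> because the endpoints of \<open>M\<close> meet every violated pair.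
\<close>

subsection \<open>Duality for the assignment problem\<close>

text \<open>Fibres of size at most two, in first-order form. When two such maps give the ends of
  each edge, \<open>E\<close> is a bipartite multigraph of maximum degree two; edges are abstract,
  so parallel ones are allowed.\<close>

definition two_to_one_on :: "('a \<Rightarrow> 'b) \<Rightarrow> 'a set \<Rightarrow> bool" where
  "two_to_one_on h E \<longleftrightarrow>
     (\<forall>x\<in>E. \<forall>y\<in>E. \<forall>z\<in>E. h x = h y \<and> h y = h z \<longrightarrow> x = y \<or> y = z \<or> x = z)"

lemma two_to_one_onD:
  assumes "two_to_one_on h E" "x \<in> E" "y \<in> E" "z \<in> E" "h x = h y" "h y = h z"
  shows "x = y \<or> y = z \<or> x = z"
  using assms unfolding two_to_one_on_def by metis

lemma two_to_one_on_subset: "two_to_one_on h E \<Longrightarrow> F \<subseteq> E \<Longrightarrow> two_to_one_on h F"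
  unfolding two_to_one_on_def by (simp add: subset_iff)

text \<open>
  Induction step: two edges \<open>e, e'\<close> with a common \<open>s\<close>-end are removed and their \<open>t\<close>-ends are
  identified. Each of the two edges can then be put on one side, as the remaining edges at the
  merged end lie on different sides.
\<close>

lemma split_two_matchings:
  assumes "finite E" "two_to_one_on s E" "two_to_one_on t E"
  shows "\<exists>S\<subseteq>E. inj_on s S \<and> inj_on s (E - S) \<and> inj_on t S \<and> inj_on t (E - S)"
  using assms
proof (induction "card E" arbitrary: E t rule: less_induct)
  case less
  note fin = less.prems(1) and s3 = less.prems(2) and t3 = less.prems(3)
  show ?case
  proof (cases "inj_on s E")
    \<comment> \<open>No two edges share an \<open>s\<close>-end, so only \<open>t\<close> matters:
      \<open>R\<close> takes one edge from each fibre of \<open>t\<close>, which leaves at most one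
      per fibre.\<close>
    case True
    obtain R where R: "R \<subseteq> E" "inj_on t R" "t ` E = t ` R"
      using iffD1[OF subset_image_inj[of "t ` E" t E] order_refl] by auto
    have "inj_on t (E - R)"
    proof (rule inj_onI)
      fix e1 e2
      assume e: "e1 \<in> E - R" "e2 \<in> E - R" "t e1 = t e2"
      then obtain e3 where "e3 \<in> R" "t e2 = t e3"
        using imageI[of e2 E t] unfolding R(3) by auto
      then show "e1 = e2"
        using two_to_one_onD[OF t3, of e1 e2 e3] e R(1) by blast
    qed
    moreover have "inj_on s R" "inj_on s (E - R)"
      using R(1) by (auto intro: inj_on_subset[OF True])
    ultimately show ?thesis using R(1,2) by auto
  next
    case False
    then obtain e e' where e: "e \<in> E" "e' \<in> E" "e \<noteq> e'" "s e = s e'"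
      unfolding inj_on_def by blast
    define E' where "E' = E - {e, e'}"
    define t' where "t' g = (if t g = t e' then t e else t g)" for g
    have sub: "E' \<subseteq> E" and out: "e \<notin> E'" "e' \<notin> E'"
      by (auto simp: E'_def)
    \<comment> \<open>A removed edge occupies one of the two places at \<open>t e\<close> and at
      \<open>t e'\<close>, so each has room for at most one remaining edge.\<close>
    have u: "g = h" if g: "g \<in> E'" "h \<in> E'" "t g = t h" "t g = t e \<or> t g = t e'" for g h
    proof -
      have ne: "g \<in> E" "h \<in> E" "h \<noteq> e" "g \<noteq> e" "h \<noteq> e'" "g \<noteq> e'"
        using g(1,2) out sub by blast+
      from g(4) show ?thesis
      proof
        assume "t g = t e"
        then have "t h = t e" using g(3) by simp
        then show ?thesis using two_to_one_onD[OF t3 ne(1,2) e(1) g(3)] ne by blast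
      next
        assume "t g = t e'"
        then have "t h = t e'" using g(3) by simp
        then show ?thesis using two_to_one_onD[OF t3 ne(1,2) e(2) g(3)] ne by blast
      qed
    qed
    \<comment> \<open>Otherwise \<open>e\<close>, \<open>e'\<close> and \<open>g\<close> would be
      three edges at one \<open>t\<close>-end.\<close>
    have te: "t e \<noteq> t e'" if g: "g \<in> E'" "t g = t e \<or> t g = t e'" for g
    proof
      assume eq: "t e = t e'"
      then have "t g = t e" using g(2) by simp
      then show False
        using two_to_one_onD[OF t3 _ e(1,2) _ eq, of g] e(3) g(1) out sub by blast
    qed
    have sE: "s g \<noteq> s e \<and> s g \<noteq> s e'" if g: "g \<in> E'" for g
      using two_to_one_onD[OF s3 _ e(1,2) _ e(4), of g] e(3,4) g out sub by force
    have "card E' < card E"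
      unfolding E'_def using fin e(1) by (intro psubset_card_mono) auto
    moreover have "finite E'" using fin E'_def by simp
    moreover have "two_to_one_on s E'"
      using two_to_one_on_subset[OF s3 sub] .
    moreover have "two_to_one_on t' E'"
      unfolding two_to_one_on_def
    proof (intro ballI impI)
      fix e1 e2 e3
      assume a: "e1 \<in> E'" "e2 \<in> E'" "e3 \<in> E'" "t' e1 = t' e2 \<and> t' e2 = t' e3"
      show "e1 = e2 \<or> e2 = e3 \<or> e1 = e3"
      proof (cases "t e1 = t e \<or> t e1 = t e'")
        case True
        then have "t e2 = t e \<or> t e2 = t e'" "t e3 = t e \<or> t e3 = t e'"
          using a(4) unfolding t'_def by (auto split: if_splits)
        then have "t e1 = t e2 \<or> t e2 = t e3 \<or> t e1 = t e3" using True by auto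
        then show ?thesis
          using u[OF a(1,2)] u[OF a(2,3)] u[OF a(1,3)] True \<open>t e2 = t e \<or> t e2 = t e'\<close> by blast
      next
        case False
        then have "t e1 = t e2 \<and> t e2 = t e3"
          using a(4) unfolding t'_def by (auto split: if_splits)
        then show ?thesis using two_to_one_onD[OF t3, of e1 e2 e3] a(1-3) sub by blast
      qed
    qed
    ultimately obtain S where S: "S \<subseteq> E'" "inj_on s S" "inj_on s (E' - S)"
        "inj_on t' S" "inj_on t' (E' - S)"
      using less.hyps[of E' t'] by blast
    have tS: "inj_on t S" "inj_on t (E' - S)"
      using S(4,5) unfolding inj_on_def t'_def by simp_all
    \<comment> \<open>Remaining edges at \<open>t e\<close> and at \<open>t e'\<close> share their
      \<open>t'\<close>-end, so they lie on different sides.\<close>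
    have key: "\<not> (t f = t e \<and> t f' = t e')" if "f \<in> S \<and> f' \<in> S \<or> f \<in> E' - S \<and> f' \<in> E' - S" for f f'
    proof
      assume tt: "t f = t e \<and> t f' = t e'"
      then have "t' f = t' f'" by (simp add: t'_def)
      then have "f = f'" using that inj_onD[OF S(4), of f f'] inj_onD[OF S(5), of f f'] by argo
      then show False using tt te[of f] that S(1) by auto
    qed
    have ext: "\<exists>S\<subseteq>E. inj_on s S \<and> inj_on s (E - S) \<and> inj_on t S \<and> inj_on t (E - S)"
      if ab: "{a, b} = {e, e'}" "a \<noteq> b" "\<forall>f\<in>S. t f \<noteq> t a" "\<forall>f\<in>E' - S. t f \<noteq> t b" for a b
    proof (intro exI conjI)
      have ab': "a = e \<and> b = e' \<or> a = e' \<and> b = e"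
        using ab(1) unfolding doubleton_eq_iff .
      then show "insert a S \<subseteq> E" using S(1) sub e(1,2) by auto
      have eq: "E - insert a S = insert b (E' - S)"
        using ab' S(1) e(1-3) out unfolding E'_def by auto
      have "s g \<noteq> s a \<and> s g \<noteq> s b" if "g \<in> E'" for g
        using sE[OF that] ab' by auto
      then have "s a \<notin> s ` S" "s b \<notin> s ` (E' - S)" using S(1) by force+
      then show "inj_on s (insert a S)" "inj_on s (E - insert a S)"
        unfolding eq using S(2,3) by auto
      have "t a \<notin> t ` S" "t b \<notin> t ` (E' - S)" using ab(3,4) by force+
      then show "inj_on t (insert a S)" "inj_on t (E - insert a S)"
        unfolding eq using tS by auto
    qed
    \<comment> \<open>The condition says that some remaining edge prevents putting \<open>e\<close>
      into \<open>S\<close> and \<open>e'\<close> on the other side. In that case nothing prevents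
      the opposite placement.\<close>
    show ?thesis
    proof (cases "(\<exists>f\<in>S. t f = t e) \<or> (\<exists>f\<in>E' - S. t f = t e')")
      case True
      have no: "t f \<noteq> t g" if "f \<in> S" "g \<in> E' - S" "t g = t e \<or> t g = t e'" for f g
        using u[of f g] that S(1) by auto
      from True have "(\<forall>f\<in>S. t f \<noteq> t e') \<and> (\<forall>f\<in>E' - S. t f \<noteq> t e)"
      proof
        assume "\<exists>f\<in>S. t f = t e"
        then obtain f where f: "f \<in> S" "t f = t e" by blast
        show ?thesis
        proof (intro conjI ballI)
          show "t g \<noteq> t e'" if "g \<in> S" for g using key[of f g] f that by auto
          show "t g \<noteq> t e" if "g \<in> E' - S" for g using no[of f g] f that by auto
        qed
      next
        assume "\<exists>f\<in>E' - S. t f = t e'"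
        then obtain f where f: "f \<in> E' - S" "t f = t e'" by blast
        show ?thesis
        proof (intro conjI ballI)
          show "t g \<noteq> t e'" if "g \<in> S" for g using no[of g f] f that by auto
          show "t g \<noteq> t e" if "g \<in> E' - S" for g using key[of g f] f that by auto
        qed
      qed
      then show ?thesis using ext[of e' e] e(3) by blast
    next
      case False
      then show ?thesis using ext[of e e'] e(3) by blast
    qed
  qed
qed

definition bip_matching :: "('a \<times> 'b) set \<Rightarrow> ('a \<times> 'b) set \<Rightarrow> bool" where
  "bip_matching E P \<longleftrightarrow> P \<subseteq> E \<and> inj_on fst P \<and> inj_on snd P"

text \<open>The multiset union of \<open>A\<close>, \<open>B\<close> and \<open>e\<close> has degree
  at most two everywhere, since \<open>e\<close> misses \<open>A\<close> on the left and
  \<open>B\<close> on the right; hence it splits into two matchings of the same total weight. A left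
  vertex outside \<open>B\<close> and off \<open>e\<close> has degree at most one there, so only one
  of the two can cover it.\<close>

lemma bip_matching_exchange:
  fixes w :: "'a \<times> 'b \<Rightarrow> real"
  assumes fin: "finite E" and A: "bip_matching E A" and B: "bip_matching E B"
    and e: "e \<in> E" "fst e \<notin> fst ` A" "snd e \<notin> snd ` B"
  obtains P Q where "bip_matching E P" "bip_matching E Q"
    "sum w P + sum w Q = sum w A + sum w B + w e"
    "\<And>x. x \<notin> fst ` B \<Longrightarrow> x \<noteq> fst e \<Longrightarrow> x \<notin> fst ` P \<or> x \<notin> fst ` Q"
proof -
  \<comment> \<open>The tags 0, 1, 2 keep apart the copies of an edge that occurs in more than one
    of the three parts.\<close>
  define U where "U = Pair (0::nat) ` A \<union> Pair 1 ` B \<union> {(2, e)}"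
  have fAB: "finite A" "finite B"
    using fin A B finite_subset unfolding bip_matching_def by blast+
  have fU: "finite U" unfolding U_def using fAB by simp
  have injs: "inj_on fst A" "inj_on snd A" "inj_on fst B" "inj_on snd B"
    using A B unfolding bip_matching_def by auto
  have "\<exists>S\<subseteq>U. inj_on (fst \<circ> snd) S \<and> inj_on (fst \<circ> snd) (U - S) \<and> inj_on (snd \<circ> snd) S \<and> inj_on (snd \<circ> snd) (U - S)"
  proof (rule split_two_matchings[OF fU])
    show "two_to_one_on (fst \<circ> snd) U"
      unfolding two_to_one_on_def
    proof (intro ballI impI)
      fix e1 e2 e3
      assume a: "e1 \<in> U" "e2 \<in> U" "e3 \<in> U" "(fst \<circ> snd) e1 = (fst \<circ> snd) e2 \<and> (fst \<circ> snd) e2 = (fst \<circ> snd) e3"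
      show "e1 = e2 \<or> e2 = e3 \<or> e1 = e3"
      proof -
        have same: "p = q" if "p \<in> U" "q \<in> U" "fst p = fst q" "fst (snd p) = fst (snd q)" for p q
          using that unfolding U_def
          by (auto dest: inj_onD[OF injs(1)] inj_onD[OF injs(3)])
        have tags: "fst p = 0 \<or> fst p = 1 \<or> fst p = 2" if "p \<in> U" for p
          using that unfolding U_def by auto
        have no: "\<not> (fst p = 0 \<and> fst q = 2)" if "p \<in> U" "q \<in> U" "fst (snd p) = fst (snd q)" for p q
          using that e(2) unfolding U_def by (auto simp: image_iff)
        have eqs: "fst (snd e1) = fst (snd e2)" "fst (snd e2) = fst (snd e3)" "fst (snd e1) = fst (snd e3)"
          using a(4) by auto
        show ?thesis
          using tags[OF a(1)] tags[OF a(2)] tags[OF a(3)] same[OF a(1,2) _ eqs(1)]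
            same[OF a(2,3) _ eqs(2)] same[OF a(1,3) _ eqs(3)]
            no[OF a(1,2) eqs(1)] no[OF a(2,3) eqs(2)] no[OF a(1,3) eqs(3)]
            no[OF a(2,1) eqs(1)[symmetric]] no[OF a(3,2) eqs(2)[symmetric]] no[OF a(3,1) eqs(3)[symmetric]]
          by (elim disjE) auto
      qed
    qed
    show "two_to_one_on (snd \<circ> snd) U"
      unfolding two_to_one_on_def
    proof (intro ballI impI)
      fix e1 e2 e3
      assume a: "e1 \<in> U" "e2 \<in> U" "e3 \<in> U" "(snd \<circ> snd) e1 = (snd \<circ> snd) e2 \<and> (snd \<circ> snd) e2 = (snd \<circ> snd) e3"
      show "e1 = e2 \<or> e2 = e3 \<or> e1 = e3"
      proof -
        have same: "p = q" if "p \<in> U" "q \<in> U" "fst p = fst q" "snd (snd p) = snd (snd q)" for p q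
          using that unfolding U_def
          by (auto dest: inj_onD[OF injs(2)] inj_onD[OF injs(4)])
        have tags: "fst p = 0 \<or> fst p = 1 \<or> fst p = 2" if "p \<in> U" for p
          using that unfolding U_def by auto
        have no: "\<not> (fst p = 1 \<and> fst q = 2)" if "p \<in> U" "q \<in> U" "snd (snd p) = snd (snd q)" for p q
          using that e(3) unfolding U_def by (auto simp: image_iff)
        have eqs: "snd (snd e1) = snd (snd e2)" "snd (snd e2) = snd (snd e3)" "snd (snd e1) = snd (snd e3)"
          using a(4) by auto
        show ?thesis
          using tags[OF a(1)] tags[OF a(2)] tags[OF a(3)] same[OF a(1,2) _ eqs(1)]
            same[OF a(2,3) _ eqs(2)] same[OF a(1,3) _ eqs(3)]
            no[OF a(1,2) eqs(1)] no[OF a(2,3) eqs(2)] no[OF a(1,3) eqs(3)]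
            no[OF a(2,1) eqs(1)[symmetric]] no[OF a(3,2) eqs(2)[symmetric]] no[OF a(3,1) eqs(3)[symmetric]]
          by (elim disjE) auto
      qed
    qed
  qed
  then obtain S where S: "S \<subseteq> U" "inj_on (fst \<circ> snd) S" "inj_on (fst \<circ> snd) (U - S)"
    "inj_on (snd \<circ> snd) S" "inj_on (snd \<circ> snd) (U - S)" by blast
  have UE: "snd ` U \<subseteq> E"
    using A B e(1) unfolding U_def bip_matching_def by auto
  have m: "bip_matching E (snd ` T)" "sum w (snd ` T) = sum (w \<circ> snd) T"
    if "T \<subseteq> U" "inj_on (fst \<circ> snd) T" "inj_on (snd \<circ> snd) T" for T
  proof -
    show "bip_matching E (snd ` T)"
      unfolding bip_matching_def using UE that by (auto simp: inj_on_def)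
    have "inj_on snd T" using that(2) by (rule inj_on_imageI2)
    then show "sum w (snd ` T) = sum (w \<circ> snd) T" by (rule sum.reindex)
  qed
  have "sum (w \<circ> snd) U = sum w A + sum w B + w e"
  proof -
    have "sum (w \<circ> snd) U = sum (w \<circ> snd) (Pair (0::nat) ` A) + sum (w \<circ> snd) (Pair (1::nat) ` B) + w e"
      unfolding U_def using fAB by (subst sum.union_disjoint; (subst sum.union_disjoint)?) (auto simp del: One_nat_def)
    then show ?thesis
      by (simp add: sum.reindex inj_on_def comp_def)
  qed
  moreover have "sum (w \<circ> snd) U = sum (w \<circ> snd) S + sum (w \<circ> snd) (U - S)"
    using sum.subset_diff[OF S(1) fU, of "w \<circ> snd"] by simp
  moreover have "x \<notin> fst ` snd ` S \<or> x \<notin> fst ` snd ` (U - S)" if x: "x \<notin> fst ` B" "x \<noteq> fst e" for x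
  proof (rule ccontr)
    assume "\<not> ?thesis"
    then obtain p q where pq: "p \<in> S" "q \<in> U - S" "fst (snd p) = x" "fst (snd q) = x" by auto
    have "r = (0, snd r) \<and> snd r \<in> A" if "r \<in> U" "fst (snd r) = x" for r
      using that x unfolding U_def by auto
    then have "p = (0, snd p)" "q = (0, snd q)" "snd p \<in> A" "snd q \<in> A"
      using pq S(1) by blast+
    then have "p = q" using injs(1) pq(3,4) unfolding inj_on_def by metis
    then show False using pq by blast
  qed
  ultimately show thesis
    using that[of "snd ` S" "snd ` (U - S)"] m[of S] m[of "U - S"] S by auto
qed

lemma max_weight_subset:
  fixes w :: "'c \<Rightarrow> real"
  assumes "finite E" "C {}"
  obtains N where "N \<subseteq> E" "C N" "\<And>P. P \<subseteq> E \<Longrightarrow> C P \<Longrightarrow> sum w P \<le> sum w N"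
proof -
  let ?F = "{P \<in> Pow E. C P}"
  have F: "finite ?F" "?F \<noteq> {}" using assms by auto
  then have "Max (sum w ` ?F) \<in> sum w ` ?F" by (intro Max_in) auto
  then obtain N where N: "N \<in> ?F" "sum w N = Max (sum w ` ?F)" by auto
  show thesis
  proof (rule that[of N])
    show "sum w P \<le> sum w N" if "P \<subseteq> E" "C P" for P
      unfolding N(2) using F that by (intro Max_ge) auto
  qed (use N in auto)
qed

text \<open>
  The potential \<open>\<alpha> x\<close> is the loss in optimal weight caused by deleting \<open>x\<close>. Feasibility follows
  by exchanging edges between \<open>M\<close> and an optimal matching that avoids \<open>x\<close>.
\<close>

lemma assignment_duality:
  fixes w :: "'a \<times> 'b \<Rightarrow> real"
  assumes fin: "finite E"
  obtains M \<alpha> \<beta> where "bip_matching E M"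
    "\<And>P. bip_matching E P \<Longrightarrow> sum w P \<le> sum w M"
    "\<And>x y. (x, y) \<in> E \<Longrightarrow> w (x, y) \<le> \<alpha> x + \<beta> y"
    "\<And>x y. (x, y) \<in> M \<Longrightarrow> \<alpha> x + \<beta> y = w (x, y)"
    "\<And>x. \<alpha> x \<ge> 0" "\<And>y. \<beta> y \<ge> 0"
    "\<And>x. x \<notin> fst ` M \<Longrightarrow> \<alpha> x = 0" "\<And>y. y \<notin> snd ` M \<Longrightarrow> \<beta> y = 0"
proof -
  obtain M where M: "bip_matching E M" "\<And>P. bip_matching E P \<Longrightarrow> sum w P \<le> sum w M"
    using max_weight_subset[OF fin, of "bip_matching E" w] unfolding bip_matching_def by auto
  have finM: "finite M" using M(1) fin finite_subset unfolding bip_matching_def by blast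
  have "\<forall>x. \<exists>N. bip_matching E N \<and> x \<notin> fst ` N \<and>
      (\<forall>P. bip_matching E P \<and> x \<notin> fst ` P \<longrightarrow> sum w P \<le> sum w N)"
  proof
    fix x
    obtain N where N: "N \<subseteq> E" "bip_matching E N \<and> x \<notin> fst ` N"
      "\<And>P. P \<subseteq> E \<Longrightarrow> bip_matching E P \<and> x \<notin> fst ` P \<Longrightarrow> sum w P \<le> sum w N"
      using max_weight_subset[OF fin, of "\<lambda>P. bip_matching E P \<and> x \<notin> fst ` P" w]
      unfolding bip_matching_def by auto
    then show "\<exists>N. bip_matching E N \<and> x \<notin> fst ` N \<and>
        (\<forall>P. bip_matching E P \<and> x \<notin> fst ` P \<longrightarrow> sum w P \<le> sum w N)"
      unfolding bip_matching_def by (intro exI[of _ N]) auto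
  qed
  from choice[OF this] obtain N where N': "\<forall>x. bip_matching E (N x) \<and> x \<notin> fst ` N x \<and>
      (\<forall>P. bip_matching E P \<and> x \<notin> fst ` P \<longrightarrow> sum w P \<le> sum w (N x))" ..
  then have N: "\<And>x. bip_matching E (N x)" "\<And>x. x \<notin> fst ` N x"
    "\<And>x P. bip_matching E P \<Longrightarrow> x \<notin> fst ` P \<Longrightarrow> sum w P \<le> sum w (N x)"
    by simp_all
  define \<alpha> where "\<alpha> x = sum w M - sum w (N x)" for x
  \<comment> \<open>The sum has at most one term: the value forced by tightness at a matched
    \<open>y\<close>, and the empty sum 0 elsewhere.\<close>
  define \<beta> where "\<beta> y = (\<Sum>x | (x, y) \<in> M. w (x, y) - \<alpha> x)" for y
  have injM: "x = x'" if "(x, y) \<in> M" "(x', y) \<in> M" for x x' y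
    using M(1) that unfolding bip_matching_def inj_on_def by fastforce
  have injM': "y = y'" if "(x, y) \<in> M" "(x, y') \<in> M" for x y y'
    using M(1) that unfolding bip_matching_def inj_on_def by fastforce
  have \<beta>M: "\<beta> y = w (x, y) - \<alpha> x" if "(x, y) \<in> M" for x y
  proof -
    have "{x'. (x', y) \<in> M} = {x}" using that injM by blast
    then show ?thesis by (simp add: \<beta>_def)
  qed
  have \<beta>0: "\<beta> y = 0" if "y \<notin> snd ` M" for y
  proof -
    have "{x'. (x', y) \<in> M} = {}" using that by (force simp: image_iff)
    then show ?thesis by (simp add: \<beta>_def)
  qed
  have del: "bip_matching E (M - {e})" "e \<in> M \<Longrightarrow> sum w (M - {e}) = sum w M - w e" for e
    using M(1) finM by (auto simp: bip_matching_def sum_diff1 intro: inj_on_subset)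
  have \<alpha>0: "\<alpha> x \<ge> 0" for x
    unfolding \<alpha>_def using M(2)[OF N(1)] by simp
  have bnd: "w (x, y) \<le> \<alpha> x + \<beta> y" if E: "(x, y) \<in> E" for x y
  proof (cases "y \<in> snd ` M")
    \<comment> \<open>With \<open>y\<close> unmatched, \<open>(x, y)\<close> can be exchanged
      between \<open>N x\<close> and \<open>M\<close> directly; both resulting matchings weigh at
      most as much as \<open>M\<close>.\<close>
    case False
    obtain P Q where PQ: "bip_matching E P" "bip_matching E Q"
        "sum w P + sum w Q = sum w (N x) + sum w M + w (x, y)"
    proof (rule bip_matching_exchange[OF fin N(1)[of x] M(1) E, of w])
      show "fst (x, y) \<notin> fst ` N x" "snd (x, y) \<notin> snd ` M" using N(2) False by simp_all
    qed (rule that)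
    then show ?thesis
      using M(2)[OF PQ(1)] M(2)[OF PQ(2)] \<beta>0[OF False] unfolding \<alpha>_def by simp
  next
    case True
    then obtain x' where x': "(x', y) \<in> M" by auto
    show ?thesis
    proof (cases "x' = x")
      case True
      then show ?thesis using \<beta>M x' by simp
    next
      \<comment> \<open>The edge \<open>(x', y)\<close> is first deleted to free \<open>y\<close>.
        Then \<open>x'\<close> is missed by one of \<open>P\<close> and \<open>Q\<close>, which is
        therefore bounded by \<open>N x'\<close>, the other by \<open>M\<close>.\<close>
      case False
      have y: "y \<notin> snd ` (M - {(x', y)})" using injM x' by auto
      have x'B: "x' \<notin> fst ` (M - {(x', y)})" using injM' x' by auto
      obtain P Q where PQ: "bip_matching E P" "bip_matching E Q"
          "sum w P + sum w Q = sum w (N x) + sum w (M - {(x', y)}) + w (x, y)"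
          "x' \<notin> fst ` P \<or> x' \<notin> fst ` Q"
      proof (rule bip_matching_exchange[OF fin N(1)[of x] del(1)[of "(x', y)"] E, of w])
        show "fst (x, y) \<notin> fst ` N x" "snd (x, y) \<notin> snd ` (M - {(x', y)})" using N(2) y by simp_all
      qed (rule that, use x'B False in auto)
      then have "sum w P + sum w Q \<le> sum w M + sum w (N x')"
        using M(2)[OF PQ(1)] M(2)[OF PQ(2)] N(3)[of P x'] N(3)[of Q x'] by fastforce
      then show ?thesis
        using PQ(3) del(2)[OF x'] \<beta>M[OF x'] unfolding \<alpha>_def by simp
    qed
  qed
  have \<beta>ge: "\<beta> y \<ge> 0" for y
  proof (cases "y \<in> snd ` M")
    case True
    then obtain x where x: "(x, y) \<in> M" by auto
    \<comment> \<open>Deleting the edge at \<open>x\<close> costs \<open>w (x, y)\<close>, so the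
      loss \<open>\<alpha> x\<close> is at most that.\<close>
    then have "x \<notin> fst ` (M - {(x, y)})" using injM' by auto
    then show ?thesis
      using N(3)[OF del(1)] del(2)[OF x] \<beta>M[OF x] unfolding \<alpha>_def by fastforce
  qed (simp add: \<beta>0)
  have "\<alpha> x = 0" if "x \<notin> fst ` M" for x
    using N(3)[OF M(1) that] \<alpha>0[of x] unfolding \<alpha>_def by simp
  then show thesis
    using that[OF M, where \<alpha>=\<alpha> and \<beta>=\<beta>] bnd \<beta>M \<alpha>0 \<beta>0 \<beta>ge by simp
qed

subsection \<open>Binary digit sums\<close>

definition popcount :: "nat \<Rightarrow> nat" where
  "popcount n = card {a. bit n a}"

lemma bit_nat_imp_le: "bit (n::nat) a \<Longrightarrow> 2 ^ a \<le> n"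
  by (metis bit_iff_odd div_less even_zero not_le)

lemma bit_nat_imp_less: "bit (n::nat) a \<Longrightarrow> a < n"
  using bit_nat_imp_le[of n a] less_exp[of a] by linarith

lemma finite_bits_nat: "finite {a. bit (n::nat) a}"
  by (rule finite_subset[of _ "{..<n}"]) (auto dest: bit_nat_imp_less)

lemma popcount_rec: "popcount n = n mod 2 + popcount (n div 2)"
proof -
  have "{a. bit n a} = (if odd n then {0} else {}) \<union> Suc ` {a. bit (n div 2) a}"
  proof (rule set_eqI)
    fix a show "a \<in> {a. bit n a} \<longleftrightarrow> a \<in> (if odd n then {0} else {}) \<union> Suc ` {a. bit (n div 2) a}"
      by (cases a) (auto simp: bit_0 bit_Suc)
  qed
  then have "popcount n = card (if odd n then {0::nat} else {}) + card (Suc ` {a. bit (n div 2) a})"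
    unfolding popcount_def using finite_bits_nat by (simp add: card_Un_disjoint)
  then show ?thesis
    by (auto simp: popcount_def card_image odd_iff_mod_2_eq_one even_iff_mod_2_eq_zero)
qed

lemma popcount_Suc_le: "popcount (Suc n) \<le> Suc (popcount n)"
proof (induction n rule: less_induct)
  case (less n)
  show ?case
  proof (cases "even n")
    case True
    then show ?thesis using popcount_rec[of n] popcount_rec[of "Suc n"] by (auto elim!: evenE)
  next
    case False
    then obtain k where k: "n = 2 * k + 1" by (auto elim: oddE)
    then show ?thesis
      using popcount_rec[of n] popcount_rec[of "Suc n"] less[of k] by simp
  qed
qed

lemma popcount_add_pow_le: "popcount (n + 2 ^ a) \<le> Suc (popcount n)"
proof (induction a arbitrary: n)
  case 0
  then show ?case using popcount_Suc_le by simp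
next
  case (Suc a)
  then show ?case
    using popcount_rec[of "n + 2 ^ Suc a"] popcount_rec[of n] Suc[of "n div 2"] by (simp add: add.commute)
qed

lemma popcount_diff_pow: "bit n a \<Longrightarrow> popcount n = Suc (popcount (n - 2 ^ a))"
proof (induction a arbitrary: n)
  case 0
  then obtain k where "n = 2 * k + 1" by (auto simp: bit_0 elim: oddE)
  then show ?case using popcount_rec[of n] popcount_rec[of "n - 1"] by simp
next
  case (Suc a)
  then have b: "bit (n div 2) a" by (simp add: bit_Suc)
  have "2 * 2 ^ a \<le> n" using bit_nat_imp_le[OF Suc.prems] by simp
  then obtain m where m: "n = m + 2 * 2 ^ a" by (metis add.commute le_Suc_ex)
  then show ?case
    using popcount_rec[of n] popcount_rec[of m] Suc.IH[OF b] by simp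
qed

text \<open>The addition clears bit \<open>a\<close>, which lowers the digit sum by one, and carries
  \<open>2 ^ Suc a\<close>, which raises it by at most one.\<close>

lemma popcount_add_pow_carry:
  assumes "bit n a" shows "popcount (n + 2 ^ a) \<le> popcount n"
proof -
  have "n + 2 ^ a = (n - 2 ^ a) + 2 ^ Suc a" using bit_nat_imp_le[OF assms] by simp
  then show ?thesis
    using popcount_add_pow_le[of "n - 2 ^ a" "Suc a"] popcount_diff_pow[OF assms] by metis
qed

lemma popcount_pos: "n > 0 \<Longrightarrow> \<exists>a. bit (n::nat) a"
  by (metis bit_eqI bit_0_eq bot_apply bot_bool_def gr0_conv_Suc nat.distinct(1))

subsection \<open>Violated pairs and shifts\<close>

text \<open>The length of a walk that adds the set bits of every coordinate difference one at a
  time. Subtraction is truncated, so the value is meaningful for \<open>x \<le> y\<close>.\<close>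

definition bit_dist :: "nat \<Rightarrow> (nat \<Rightarrow> nat) \<Rightarrow> (nat \<Rightarrow> nat) \<Rightarrow> nat" where
  "bit_dist d x y = (\<Sum>i\<in>{1..d}. popcount (y i - x i))"

text \<open>The result may leave the grid; membership is a separate condition, which keeps the map
  total and injective.\<close>

definition shift :: "nat \<Rightarrow> nat \<Rightarrow> (nat \<Rightarrow> nat) \<Rightarrow> nat \<Rightarrow> nat" where
  "shift i a x = x(i := x i + 2 ^ a)"

lemma finite_hypergrid: "finite (hypergrid n d)"
  unfolding hypergrid_def by (intro finite_PiE) auto

lemma hypergrid_bounds:
  assumes "x \<in> hypergrid n d" "i \<in> {1..d}" shows "1 \<le> x i" "x i \<le> n"
  using assms unfolding hypergrid_def by (auto simp: PiE_iff)

lemma hypergrid_upd: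
  assumes "x \<in> hypergrid n d" "i \<in> {1..d}" "1 \<le> v" "v \<le> n"
  shows "x(i := v) \<in> hypergrid n d"
  using assms unfolding hypergrid_def by (auto simp: PiE_iff extensional_def)

lemma shift_in_hypergrid:
  assumes "x \<in> hypergrid n d" "i \<in> {1..d}" "x i + 2 ^ a \<le> n"
  shows "shift i a x \<in> hypergrid n d"
  unfolding shift_def using assms hypergrid_bounds[OF assms(1,2)] by (intro hypergrid_upd) auto

lemma shift_mono: "x \<le> y \<Longrightarrow> shift i a x \<le> shift i a y"
  by (simp add: shift_def le_fun_def)

lemma shift_le: "x \<le> y \<Longrightarrow> x i + 2 ^ a \<le> y i \<Longrightarrow> shift i a x \<le> y"
  by (simp add: shift_def le_fun_def)

lemma inj_shift: "inj (shift i a)"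
proof (rule injI, rule ext)
  fix x y j assume "shift i a x = shift i a y"
  from fun_cong[OF this, of j] show "x j = y j"
    by (simp add: shift_def split: if_splits)
qed

lemma bit_dist_shift: "bit_dist d (shift i a x) (shift i a y) = bit_dist d x y"
  unfolding bit_dist_def shift_def by (intro sum.cong) auto

lemma bit_dist_remove:
  "i \<in> {1..d} \<Longrightarrow> bit_dist d x y = popcount (y i - x i) + (\<Sum>j\<in>{1..d} - {i}. popcount (y j - x j))"
  unfolding bit_dist_def by (rule sum.remove) auto

lemma bit_dist_shift_left:
  assumes "x \<le> y" "i \<in> {1..d}" "bit (y i - x i) a"
  shows "bit_dist d x y = Suc (bit_dist d (shift i a x) y)"
proof -
  have "popcount (y i - x i) = Suc (popcount (y i - shift i a x i))"
    using popcount_diff_pow[OF assms(3)] by (simp add: shift_def)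
  then show ?thesis
    unfolding bit_dist_remove[OF assms(2)] by (simp add: shift_def)
qed

lemma bit_dist_shift_right:
  assumes "x \<le> y" "i \<in> {1..d}" "bit (y i - x i) a"
  shows "bit_dist d x (shift i a y) \<le> bit_dist d x y"
proof -
  \<comment> \<open>This lets the added \<open>2 ^ a\<close> be pulled out of the truncated
    difference.\<close>
  have "x i \<le> y i" using assms(1) by (simp add: le_fun_def)
  then have "popcount (shift i a y i - x i) \<le> popcount (y i - x i)"
    using popcount_add_pow_carry[OF assms(3)] by (simp add: shift_def)
  then show ?thesis
    unfolding bit_dist_remove[OF assms(2)] by (simp add: shift_def)
qed

lemma popcount_eq_0_iff: "popcount n = 0 \<longleftrightarrow> n = 0"
  unfolding popcount_def using finite_bits_nat[of n] popcount_pos[of n] by auto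

lemma bit_diff_shift_le:
  fixes x y :: "'b \<Rightarrow> nat"
  assumes "x \<le> y" "bit (y i - x i) a" shows "x i + 2 ^ a \<le> y i"
  using bit_nat_imp_le[OF assms(2)] assms(1) by (simp add: le_fun_def le_diff_conv2 add.commute)

text \<open>Each step adds the power of two of one set bit of some difference. The new point stays
  below \<open>y\<close>, hence in the grid, and is closer by exactly one.\<close>

lemma bit_dist_walk:
  assumes "x \<in> hypergrid n d" "y \<in> hypergrid n d" "x \<le> y"
  shows "(x, y) \<in> augmented_edges n d ^^ bit_dist d x y"
  using assms(1,3)
proof (induction "bit_dist d x y" arbitrary: x)
  case 0
  then have "\<forall>i\<in>{1..d}. y i - x i = 0"
    by (simp add: bit_dist_def popcount_eq_0_iff)
  then have "x i = y i" if "i \<in> {1..d}" for i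
    using that 0(3) by (meson diff_is_0_eq le_antisym le_funD)
  then have "x = y"
    using 0(2) assms(2) unfolding hypergrid_def by (intro PiE_ext) auto
  then show ?case using 0(1) by simp
next
  case (Suc k)
  have "bit_dist d x y \<noteq> 0" using Suc.hyps(2) by simp
  then obtain i where i: "i \<in> {1..d}" and "popcount (y i - x i) \<noteq> 0"
    unfolding bit_dist_def by (auto simp: sum_eq_0_iff)
  then obtain a where a: "bit (y i - x i) a"
    using popcount_pos[of "y i - x i"] by (auto simp: popcount_eq_0_iff)
  have le: "x i + 2 ^ a \<le> y i" using bit_diff_shift_le Suc.prems(2) a .
  then have S: "shift i a x \<in> hypergrid n d"
    using shift_in_hypergrid Suc.prems(1) i hypergrid_bounds[OF assms(2) i] by simp
  have "{j \<in> {1..d}. x j \<noteq> shift i a x j} = {i}"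
    "int (shift i a x i) - int (x i) = 2 ^ a"
    using i by (auto simp: shift_def)
  then have "(x, shift i a x) \<in> augmented_edges n d"
    unfolding augmented_edges_def using Suc.prems(1) S by blast
  moreover have "(shift i a x, y) \<in> augmented_edges n d ^^ k"
    using Suc.hyps(1)[of "shift i a x"] Suc.hyps(2) bit_dist_shift_left[OF Suc.prems(2) i a]
      S shift_le[OF Suc.prems(2) le] by simp
  ultimately show ?case
    using Suc.hyps(2) relpow_Suc_I2 by metis
qed

lemma augmented_dist_le_bit_dist:
  assumes "x \<in> hypergrid n d" "y \<in> hypergrid n d" "x \<le> y"
  shows "augmented_dist n d x y \<le> bit_dist d x y"
  unfolding augmented_dist_def using bit_dist_walk[OF assms] by (rule Least_le)

lemma violated_pairsI:
  assumes "x \<in> hypergrid n d" "y \<in> hypergrid n d" "x \<le> y" "f x = 1" "f y = 0"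
  shows "(x, y) \<in> violated_pairs n d f"
  using assms unfolding violated_pairs_def by (auto simp: order.strict_iff_order)

lemma violated_pairsD:
  assumes "(x, y) \<in> violated_pairs n d f"
  shows "x \<in> hypergrid n d" "y \<in> hypergrid n d" "x \<le> y" "f x = 1" "f y = 0"
  using assms unfolding violated_pairs_def by auto

text \<open>Pulls the partner \<open>z\<close> of a shifted point back along the shift. The result
  stays in the grid because \<open>z i - 2 ^ a\<close> is at least \<open>u i\<close>, hence at
  least 1.\<close>

lemma unshift:
  assumes "u \<in> hypergrid n d" "z \<in> hypergrid n d" "i \<in> {1..d}" "shift i a u \<le> z"
  obtains p where "p \<in> hypergrid n d" "u \<le> p" "shift i a p = z"
proof
  have le: "u i + 2 ^ a \<le> z i" "\<And>j. j \<noteq> i \<Longrightarrow> u j \<le> z j"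
    using assms(4) by (auto simp: shift_def le_fun_def split: if_splits)
  then show "z(i := z i - 2 ^ a) \<in> hypergrid n d"
    using hypergrid_bounds[OF assms(1,3)] hypergrid_bounds[OF assms(2,3)]
    by (intro hypergrid_upd assms) auto
  show "u \<le> z(i := z i - 2 ^ a)" using le by (auto simp: le_fun_def)
  show "shift i a (z(i := z i - 2 ^ a)) = z" using le(1) by (auto simp: shift_def)
qed

section \<open>Counting matched pairs with a given bit set\<close>

locale violation_duality =
  fixes n d :: nat and f :: "(nat \<Rightarrow> nat) \<Rightarrow> nat" and K :: real
    and M :: "((nat \<Rightarrow> nat) \<times> (nat \<Rightarrow> nat)) set" and \<alpha> \<beta> :: "(nat \<Rightarrow> nat) \<Rightarrow> real"
  assumes boolean: "u \<in> hypergrid n d \<Longrightarrow> f u = 0 \<or> f u = 1"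
    and matching: "bip_matching (violated_pairs n d f) M"
    and feasible: "(x, y) \<in> violated_pairs n d f \<Longrightarrow> K - real (bit_dist d x y) \<le> \<alpha> x + \<beta> y"
    and tight: "(x, y) \<in> M \<Longrightarrow> \<alpha> x + \<beta> y = K - real (bit_dist d x y)"
    and nonneg: "\<alpha> x \<ge> 0" "\<beta> y \<ge> 0"
    and slack: "x \<notin> fst ` M \<Longrightarrow> \<alpha> x = 0" "y \<notin> snd ` M \<Longrightarrow> \<beta> y = 0"
begin

lemma M_D:
  assumes "(x, y) \<in> M"
  shows "x \<in> hypergrid n d" "y \<in> hypergrid n d" "x \<le> y" "f x = 1" "f y = 0"
proof -
  have "(x, y) \<in> violated_pairs n d f" using assms matching unfolding bip_matching_def by auto
  from violated_pairsD[OF this]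
  show "x \<in> hypergrid n d" "y \<in> hypergrid n d" "x \<le> y" "f x = 1" "f y = 0" .
qed

text \<open>The alternating chains are not followed one by one but balanced by cardinalities:
  \<open>|B| + |D| \<le> |A1| + |V|\<close>, \<open>|A0| \<le> |D|\<close> and
  \<open>|A1| \<le> |A0| + |V|\<close> add up to \<open>|B| \<le> 2 |V|\<close>.\<close>

lemma card_bit_pairs_le:
  assumes i: "i \<in> {1..d}"
  shows "card {(x, y) \<in> M. bit (y i - x i) a}
    \<le> 2 * card {u \<in> hypergrid n d. shift i a u \<in> hypergrid n d \<and> f u = 1 \<and> f (shift i a u) = 0}"
proof -
  let ?H = "hypergrid n d" and ?s = "shift i a"
  define B where "B = {(x, y) \<in> M. bit (y i - x i) a}"
  define V where "V = {u \<in> ?H. ?s u \<in> ?H \<and> f u = 1 \<and> f (?s u) = 0}"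
  \<comment> \<open>\<open>A1\<close> and \<open>A0\<close> collect the edges in this direction
    across which \<open>\<alpha>\<close> rises between ones, respectively \<open>\<beta>\<close>
    drops between zeros. \<open>D\<close> and \<open>F\<close> are the pairs of \<open>M\<close>
    through which such changes are passed on.\<close>
  define A1 where "A1 = {u \<in> ?H. ?s u \<in> ?H \<and> f u = 1 \<and> f (?s u) = 1 \<and> \<alpha> u < \<alpha> (?s u)}"
  define A0 where "A0 = {p \<in> ?H. ?s p \<in> ?H \<and> f p = 0 \<and> f (?s p) = 0 \<and> \<beta> (?s p) < \<beta> p}"
  define D where "D = {(u, p) \<in> M. p \<in> A0}"
  define F where "F = {(u, z) \<in> M. u \<in> ?s ` A1}"
  have fin: "finite V" "finite A1" "finite A0"
    unfolding V_def A1_def A0_def using finite_hypergrid by auto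
  have finM: "finite M"
  proof (rule finite_subset)
    show "M \<subseteq> ?H \<times> ?H" using M_D by auto
  qed (simp add: finite_hypergrid)
  have inj: "inj_on fst M" "inj_on snd M" using matching unfolding bip_matching_def by auto
  have sub: "B \<subseteq> M" "D \<subseteq> M" "F \<subseteq> M" unfolding B_def D_def F_def by auto
  have up: "u \<in> A1 \<union> V" if u: "u \<in> ?H" "?s u \<in> ?H" "f u = 1"
    and lt: "f (?s u) = 1 \<Longrightarrow> \<alpha> u < \<alpha> (?s u)" for u
    using u lt boolean[OF u(2)] unfolding A1_def V_def by auto
  \<comment> \<open>The shifted left end is still below \<open>y\<close> and closer by one, so
    feasibility there against tightness at \<open>(x, y)\<close> makes \<open>\<alpha>\<close>
    rise.\<close>
  have B1: "x \<in> A1 \<union> V" if "(x, y) \<in> B" for x y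
  proof -
    have xy: "(x, y) \<in> M" and b: "bit (y i - x i) a" using that unfolding B_def by auto
    note m = M_D[OF xy]
    have le: "x i + 2 ^ a \<le> y i" using bit_diff_shift_le m(3) b .
    then have S: "?s x \<in> ?H"
      using shift_in_hypergrid m(1) i hypergrid_bounds[OF m(2) i] by simp
    show ?thesis
    proof (rule up[OF m(1) S m(4)])
      assume "f (?s x) = 1"
      then have "(?s x, y) \<in> violated_pairs n d f"
        using violated_pairsI S m(2,5) shift_le[OF m(3) le] by blast
      from feasible[OF this] show "\<alpha> x < \<alpha> (?s x)"
        using tight[OF xy] bit_dist_shift_left[OF m(3) i b] by simp
    qed
  qed
  \<comment> \<open>Shifting both ends keeps \<open>bit_dist\<close>, so a drop of
    \<open>\<beta>\<close> on the right must be compensated by a rise of \<open>\<alpha>\<close> on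
    the left.\<close>
  have D1: "u \<in> A1 \<union> V" if "(u, p) \<in> D" for u p
  proof -
    have up': "(u, p) \<in> M" and p: "?s p \<in> ?H" "f (?s p) = 0" "\<beta> (?s p) < \<beta> p"
      using that unfolding D_def A0_def by auto
    note m = M_D[OF up']
    have "u i + 2 ^ a \<le> ?s p i" using m(3) by (simp add: shift_def le_fun_def)
    then have S: "?s u \<in> ?H"
      using shift_in_hypergrid m(1) i hypergrid_bounds[OF p(1) i] by simp
    show ?thesis
    proof (rule up[OF m(1) S m(4)])
      assume "f (?s u) = 1"
      then have "(?s u, ?s p) \<in> violated_pairs n d f"
        using violated_pairsI S p shift_mono[OF m(3)] by blast
      from feasible[OF this] show "\<alpha> u < \<alpha> (?s u)"
        using tight[OF up'] p(3) by (simp add: bit_dist_shift)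
    qed
  qed
  \<comment> \<open>By the carry bound \<open>(u, ?s p)\<close> is no farther apart than
    \<open>(u, p)\<close>, so feasibility excludes a drop of \<open>\<beta>\<close> from
    \<open>p\<close> to \<open>?s p\<close>.\<close>
  have disj: "B \<inter> D = {}"
  proof -
    have False if "(u, p) \<in> B" "(u, p) \<in> D" for u p
    proof -
      have up': "(u, p) \<in> M" and b: "bit (p i - u i) a"
        and p: "?s p \<in> ?H" "f (?s p) = 0" "\<beta> (?s p) < \<beta> p"
        using that unfolding D_def B_def A0_def by auto
      note m = M_D[OF up']
      have "p \<le> ?s p" by (simp add: shift_def le_fun_def)
      then have "(u, ?s p) \<in> violated_pairs n d f"
        using violated_pairsI m(1,4) p order_trans[OF m(3)] by blast
      from feasible[OF this] show False
        using tight[OF up'] p(3) bit_dist_shift_right[OF m(3) i b] by linarith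
    qed
    then show ?thesis by auto
  qed
  have "card B + card D = card (B \<union> D)"
    using sub finM disj by (metis card_Un_disjoint finite_subset)
  also have "\<dots> = card (fst ` (B \<union> D))"
    using sub by (intro card_image[symmetric] inj_on_subset[OF inj(1)]) auto
  also have "\<dots> \<le> card (A1 \<union> V)"
  proof (rule card_mono)
    show "fst ` (B \<union> D) \<subseteq> A1 \<union> V"
    proof
      fix v assume "v \<in> fst ` (B \<union> D)"
      then obtain e where e: "e \<in> B \<union> D" "v = fst e" by blast
      then show "v \<in> A1 \<union> V" using B1[of "fst e" "snd e"] D1[of "fst e" "snd e"] by auto
    qed
  qed (use fin in simp)
  also have "\<dots> \<le> card A1 + card V" by (rule card_Un_le)
  finally have 1: "card B + card D \<le> card A1 + card V" .
  \<comment> \<open>A strict drop starts at a positive potential, and slackness then makes the point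
    matched; the same holds below for \<open>\<alpha>\<close>.\<close>
  have "A0 \<subseteq> snd ` D"
  proof
    fix p assume p: "p \<in> A0"
    then have "\<beta> p > 0" using nonneg(2)[of "?s p"] unfolding A0_def by simp
    then have "p \<in> snd ` M" using slack(2) by fastforce
    then show "p \<in> snd ` D" using p unfolding D_def by force
  qed
  then have 2: "card A0 \<le> card D"
    using finite_subset[OF sub(2) finM] by (rule surj_card_le[rotated])
  have "?s ` A1 \<subseteq> fst ` F"
  proof
    fix v assume v: "v \<in> ?s ` A1"
    then obtain u where "\<alpha> u < \<alpha> v" unfolding A1_def by auto
    then have "\<alpha> v > 0" using nonneg(1)[of u] by simp
    then have "v \<in> fst ` M" using slack(1) by fastforce
    then show "v \<in> fst ` F" using v unfolding F_def by force
  qed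
  then have "card (?s ` A1) \<le> card F"
    using finite_subset[OF sub(3) finM] by (rule surj_card_le[rotated])
  then have "card A1 \<le> card F"
    by (simp add: card_image[OF inj_on_subset[OF inj_shift subset_UNIV]])
  also have "card F = card (snd ` F)"
    using sub by (intro card_image[symmetric] inj_on_subset[OF inj(2)]) auto
  also have "\<dots> \<le> card (?s ` (A0 \<union> V))"
  proof (rule card_mono)
    show "snd ` F \<subseteq> ?s ` (A0 \<union> V)"
    proof safe
      fix v z assume "(v, z) \<in> F"
      then obtain u where vz: "(?s u, z) \<in> M" and v: "v = ?s u" and u: "u \<in> A1"
        unfolding F_def by auto
      note m = M_D[OF vz]
      have u': "u \<in> ?H" "f u = 1" "\<alpha> u < \<alpha> (?s u)" using u unfolding A1_def by auto
      obtain p where p: "p \<in> ?H" "u \<le> p" "?s p = z"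
        using unshift[OF u'(1) m(2) i m(3)] .
      \<comment> \<open>Either \<open>(p, z)\<close> is a negative edge, or \<open>(u, p)\<close> is
        a violated pair at the same distance as the tight pair \<open>(?s u, z)\<close>, and the
        rise of \<open>\<alpha>\<close> forces a drop of \<open>\<beta>\<close>.\<close>
      have "p \<in> A0 \<union> V"
      proof (cases "f p = 0")
        case True
        then have "(u, p) \<in> violated_pairs n d f" using violated_pairsI u' p by blast
        from feasible[OF this] have "\<beta> (?s p) < \<beta> p"
          using tight[OF vz] u'(3) p(3) bit_dist_shift[of d i a u p] by simp
        then show ?thesis using True p m unfolding A0_def by auto
      next
        case False
        then show ?thesis using boolean[OF p(1)] p m unfolding V_def by auto
      qed
      then show "snd (v, z) \<in> ?s ` (A0 \<union> V)" using p(3) by auto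
    qed
  qed (use fin in auto)
  also have "\<dots> \<le> card (A0 \<union> V)" using fin by (intro card_image_le) auto
  also have "\<dots> \<le> card A0 + card V" by (rule card_Un_le)
  finally have "card A1 \<le> card A0 + card V" .
  then have "card B \<le> 2 * card V" using 1 2 by linarith
  then show ?thesis unfolding B_def V_def .
qed

end

section \<open>Maximal matchings and distance to monotonicity\<close>

lemma finite_violated_pairs: "finite (violated_pairs n d f)"
proof (rule finite_subset)
  show "violated_pairs n d f \<subseteq> hypergrid n d \<times> hypergrid n d"
    unfolding violated_pairs_def by auto
qed (simp add: finite_hypergrid)

text \<open>Left ends have value 1 and right ends value 0, so two pairs can meet only left with left
  or right with right.\<close>

lemma violation_matching_iff:
  "violation_matching n d f M \<longleftrightarrow> bip_matching (violated_pairs n d f) M"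
proof
  assume m: "violation_matching n d f M"
  then have "M \<subseteq> violated_pairs n d f" unfolding violation_matching_def by simp
  moreover have eq: "p = q" if "p \<in> M" "q \<in> M" "{fst p, snd p} \<inter> {fst q, snd q} \<noteq> {}" for p q
  proof (cases p, cases q)
    fix x y x' y' assume pq: "p = (x, y)" "q = (x', y')"
    have "(x, y) \<noteq> (x', y') \<longrightarrow> {x, y} \<inter> {x', y'} = {}"
      using m that(1,2) unfolding violation_matching_def pq by fast
    then show "p = q" using that(3) pq by auto
  qed
  have "inj_on fst M" "inj_on snd M" by (rule inj_onI, rule eq, auto)+
  ultimately show "bip_matching (violated_pairs n d f) M" unfolding bip_matching_def by simp
next
  assume m: "bip_matching (violated_pairs n d f) M"
  then have sub: "M \<subseteq> violated_pairs n d f" and inj: "inj_on fst M" "inj_on snd M"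
    unfolding bip_matching_def by auto
  have "{x, y} \<inter> {x', y'} = {}"
    if h: "(x, y) \<in> M" "(x', y') \<in> M" "(x, y) \<noteq> (x', y')" for x y x' y'
  proof -
    have "f x = 1" "f y = 0" "f x' = 1" "f y' = 0"
      using sub h(1,2) violated_pairsD(4,5) by blast+
    then have "x \<noteq> y'" "y \<noteq> x'" by auto
    moreover have "x \<noteq> x'" using inj_onD[OF inj(1) _ h(1,2)] h(3) by auto
    moreover have "y \<noteq> y'" using inj_onD[OF inj(2) _ h(1,2)] h(3) by auto
    ultimately show ?thesis by auto
  qed
  then show "violation_matching n d f M"
    using sub by (simp only: violation_matching_def Ball_def split_paired_All case_prod_conv) blast
qed

lemma card_maximal_matching_ge:
  assumes f: "f \<in> hypergrid n d \<rightarrow> {0, 1}"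
    and far: "eps_far_from_monotone n d \<epsilon> f"
    and M: "maximal_violation_matching n d f M"
  shows "\<epsilon> * real n ^ d \<le> 2 * real (card M)"
proof -
  let ?H = "hypergrid n d"
  have bip: "bip_matching (violated_pairs n d f) M"
    using M unfolding maximal_violation_matching_def violation_matching_iff by simp
  then have sub: "M \<subseteq> violated_pairs n d f" and inj: "inj_on fst M" "inj_on snd M"
    unfolding bip_matching_def by auto
  have finM: "finite M" using sub finite_violated_pairs finite_subset by blast
  define C where "C = fst ` M \<union> snd ` M"
  \<comment> \<open>The upward closure of the ones outside \<open>C\<close>. Off \<open>C\<close> it
    agrees with \<open>f\<close>, since a disagreement would give a violated pair avoiding
    \<open>C\<close>, which could be added to \<open>M\<close>.\<close>
  define g :: "(nat \<Rightarrow> nat) \<Rightarrow> nat"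
    where "g v = (if \<exists>u\<in>?H - C. u \<le> v \<and> f u = 1 then 1 else 0)" for v
  have "g \<in> ?H \<rightarrow> {0, 1}" by (simp add: g_def)
  moreover have "mono_on ?H g"
    unfolding mono_on_def g_def by (auto dest: order_trans)
  ultimately have "\<epsilon> * real n ^ d \<le> real (card {x \<in> ?H. f x \<noteq> g x})"
    using far unfolding eps_far_from_monotone_def by blast
  also have "card {x \<in> ?H. f x \<noteq> g x} \<le> card C"
  proof (rule card_mono)
    show "finite C" unfolding C_def using finM by simp
    show "{x \<in> ?H. f x \<noteq> g x} \<subseteq> C"
    proof (rule subsetI, rule ccontr)
      fix v assume v: "v \<in> {x \<in> ?H. f x \<noteq> g x}" "v \<notin> C"
      then have vH: "v \<in> ?H" and ne: "f v \<noteq> g v" by auto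
      have "f v = 0 \<or> f v = 1" using f vH by auto
      moreover have "g v = 1" if "f v = 1" using that vH v(2) unfolding g_def by auto
      ultimately have fv: "f v = 0" and "g v \<noteq> 0" using ne by auto
      then obtain u where u: "u \<in> ?H" "u \<notin> C" "u \<le> v" "f u = 1"
        unfolding g_def by (auto split: if_splits)
      have uv: "(u, v) \<in> violated_pairs n d f" using violated_pairsI u vH fv by blast
      have "bip_matching (violated_pairs n d f) (insert (u, v) M)"
        using bip uv u(2) v(2) unfolding bip_matching_def C_def by auto
      then have "insert (u, v) M = M"
        using M unfolding maximal_violation_matching_def violation_matching_iff by blast
      then have "(u, v) \<in> M" by blast
      then show False using u(2) unfolding C_def by force
    qed
  qed
  also have "card C \<le> card (fst ` M) + card (snd ` M)"
    unfolding C_def by (rule card_Un_le)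
  also have "\<dots> = 2 * card M" using inj by (simp add: card_image)
  finally show ?thesis by simp
qed

section \<open>Summation over directions and bits\<close>

lemma sum_card_shift_edges_le:
  "(\<Sum>i\<in>{1..d}. \<Sum>a<n. card {u \<in> hypergrid n d. shift i a u \<in> hypergrid n d \<and> f u = 1 \<and> f (shift i a u) = 0})
    \<le> card (negative_edges n d f)"
proof -
  let ?H = "hypergrid n d"
  define V where "V i a = {u \<in> ?H. shift i a u \<in> ?H \<and> f u = 1 \<and> f (shift i a u) = 0}" for i a
  define T where "T = (SIGMA ia:{1..d} \<times> {..<n}. V (fst ia) (snd ia))"
  define e where "e t = (snd t, shift (fst (fst t)) (snd (fst t)) (snd t))"
    for t :: "(nat \<times> nat) \<times> (nat \<Rightarrow> nat)"
  have finV: "finite (V i a)" for i a unfolding V_def using finite_hypergrid by simp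
  have "(\<Sum>i\<in>{1..d}. \<Sum>a<n. card (V i a)) = card T"
    unfolding T_def using finV by (simp add: sum.cartesian_product card_SigmaI case_prod_unfold)
  also have "\<dots> = card (e ` T)"
  \<comment> \<open>An edge determines its lower end, the coordinate that changes and the exponent
    of the increment, so nothing is counted twice.\<close>
  proof (rule card_image[symmetric], rule inj_onI)
    fix t t' assume t: "t \<in> T" "t' \<in> T" "e t = e t'"
    obtain i a u i' a' u' where tt: "t = ((i, a), u)" "t' = ((i', a'), u')"
      by (metis prod.collapse)
    have u: "u' = u" and s: "shift i a u = shift i' a' u" using t(3) tt unfolding e_def by auto
    have "i = i'"
    proof (rule ccontr)
      assume "i \<noteq> i'"
      then show False using fun_cong[OF s, of i] by (simp add: shift_def)
    qed
    moreover have "a = a'"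
      using fun_cong[OF s, of i] \<open>i = i'\<close> by (simp add: shift_def)
    ultimately show "t = t'" using tt u by simp
  qed
  also have "\<dots> \<le> card (negative_edges n d f)"
  proof (rule card_mono)
    show "finite (negative_edges n d f)"
      by (rule finite_subset[of _ "?H \<times> ?H"])
        (auto simp: negative_edges_def augmented_edges_def finite_hypergrid)
    show "e ` T \<subseteq> negative_edges n d f"
    proof (rule image_subsetI)
      fix t assume "t \<in> T"
      then obtain i a u where t: "t = ((i, a), u)" and i: "i \<in> {1..d}" and u: "u \<in> V i a"
        unfolding T_def by auto
      have "{j \<in> {1..d}. u j \<noteq> shift i a u j} = {i}"
        "int (shift i a u i) - int (u i) = 2 ^ a"
        using i by (auto simp: shift_def)
      then have "(u, shift i a u) \<in> augmented_edges n d"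
        unfolding augmented_edges_def using u unfolding V_def by blast
      then show "e t \<in> negative_edges n d f"
        using t u unfolding e_def negative_edges_def V_def by simp
    qed
  qed
  finally show ?thesis unfolding V_def .
qed

text \<open>A set bit has \<open>a < 2 ^ a \<le> m\<close>, so the crude range \<open>a < n\<close>
  contains all of them.\<close>

lemma popcount_eq_sum:
  assumes "m \<le> n" shows "popcount m = (\<Sum>a<n. if bit m a then 1 else 0)"
proof -
  have "{a. bit m a} = {..<n} \<inter> {a. bit m a}"
    using bit_nat_imp_less[of m] assms by force
  then show ?thesis unfolding popcount_def by (simp add: sum.If_cases)
qed

lemma sum_bit_dist_eq:
  assumes "finite M" and "M \<subseteq> hypergrid n d \<times> hypergrid n d"
  shows "(\<Sum>(x, y)\<in>M. bit_dist d x y) = (\<Sum>i\<in>{1..d}. \<Sum>a<n. card {(x, y) \<in> M. bit (y i - x i) a})"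
proof -
  have "bit_dist d (fst e) (snd e)
      = (\<Sum>i\<in>{1..d}. \<Sum>a<n. if bit (snd e i - fst e i) a then 1 else 0)" if "e \<in> M" for e
    unfolding bit_dist_def
  proof (intro sum.cong refl popcount_eq_sum)
    fix i assume "i \<in> {1..d}"
    then show "snd e i - fst e i \<le> n"
      using hypergrid_bounds[of "snd e" n d i] that assms(2) by fastforce
  qed
  then have "(\<Sum>(x, y)\<in>M. bit_dist d x y)
      = (\<Sum>e\<in>M. \<Sum>i\<in>{1..d}. \<Sum>a<n. if bit (snd e i - fst e i) a then 1 else 0)"
    by (simp add: case_prod_unfold)
  also have "\<dots> = (\<Sum>i\<in>{1..d}. \<Sum>a<n. \<Sum>e\<in>M. if bit (snd e i - fst e i) a then 1 else 0)"
    by (subst sum.swap, intro sum.cong refl, rule sum.swap)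
  also have "\<dots> = (\<Sum>i\<in>{1..d}. \<Sum>a<n. card {(x, y) \<in> M. bit (y i - x i) a})"
  proof (intro sum.cong refl)
    fix i a
    have "{(x, y) \<in> M. bit (y i - x i) a} = M \<inter> {e. bit (snd e i - fst e i) a}" by auto
    then show "(\<Sum>e\<in>M. if bit (snd e i - fst e i) a then 1 else 0) = card {(x, y) \<in> M. bit (y i - x i) a}"
      using assms(1) by (simp add: sum.If_cases)
  qed
  finally show ?thesis .
qed

section \<open>A short maximal matching and the influence bound\<close>

lemma ex_maximal_matching_short:
  assumes f: "f \<in> hypergrid n d \<rightarrow> {0, 1}"
  obtains M where "maximal_violation_matching n d f M"
    "(\<Sum>(x, y)\<in>M. bit_dist d x y) \<le> 2 * card (negative_edges n d f)"
proof -
  let ?E = "violated_pairs n d f"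
  \<comment> \<open>Any constant above every \<open>bit_dist\<close> of a violated pair makes all
    weights positive; the sum of all of them plus one is such a constant.\<close>
  define K where "K = real (\<Sum>(x, y)\<in>?E. bit_dist d x y) + 1"
  define w where "w e = K - real (bit_dist d (fst e) (snd e))" for e
  have wpos: "w e > 0" if "e \<in> ?E" for e
  proof -
    have "bit_dist d (fst e) (snd e) \<le> (\<Sum>(x, y)\<in>?E. bit_dist d x y)"
      using member_le_sum[OF that, of "\<lambda>(x, y). bit_dist d x y"] finite_violated_pairs
      by (simp add: case_prod_unfold)
    then show ?thesis unfolding w_def K_def by linarith
  qed
  obtain M \<alpha> \<beta> where M: "bip_matching ?E M"
    and opt: "\<And>P. bip_matching ?E P \<Longrightarrow> sum w P \<le> sum w M"
    and dual: "\<And>x y. (x, y) \<in> ?E \<Longrightarrow> w (x, y) \<le> \<alpha> x + \<beta> y"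
      "\<And>x y. (x, y) \<in> M \<Longrightarrow> \<alpha> x + \<beta> y = w (x, y)"
      "\<And>x. \<alpha> x \<ge> 0" "\<And>y. \<beta> y \<ge> 0"
      "\<And>x. x \<notin> fst ` M \<Longrightarrow> \<alpha> x = 0" "\<And>y. y \<notin> snd ` M \<Longrightarrow> \<beta> y = 0"
    by (rule assignment_duality[OF finite_violated_pairs, of n d f w]) (rule that)
  interpret violation_duality n d f K M \<alpha> \<beta>
    using f M dual by unfold_locales (auto simp: w_def)
  have finM: "finite M" and ME: "M \<subseteq> ?E"
    using M finite_violated_pairs finite_subset unfolding bip_matching_def by blast+
  have "maximal_violation_matching n d f M"
    unfolding maximal_violation_matching_def violation_matching_iff
  proof (intro conjI allI impI M)
    fix P assume P: "bip_matching ?E P \<and> M \<subseteq> P"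
    then have PE: "P \<subseteq> ?E" and finP: "finite P"
      using finite_violated_pairs finite_subset unfolding bip_matching_def by blast+
    show "P = M"
    proof (rule ccontr)
      assume "P \<noteq> M"
      then obtain e where e: "e \<in> P - M" using P by blast
      \<comment> \<open>Positive weights turn optimality into inclusion-maximality.\<close>
      have "0 < sum w (P - M)"
        using e finP PE wpos by (intro sum_pos) auto
      then show False
        using opt[of P] P sum.subset_diff[of M P w] finP by simp
    qed
  qed
  moreover have "(\<Sum>(x, y)\<in>M. bit_dist d x y) \<le> 2 * card (negative_edges n d f)"
  proof -
    have "(\<Sum>(x, y)\<in>M. bit_dist d x y) = (\<Sum>i\<in>{1..d}. \<Sum>a<n. card {(x, y) \<in> M. bit (y i - x i) a})"
      using M_D by (intro sum_bit_dist_eq finM) auto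
    also have "\<dots> \<le> (\<Sum>i\<in>{1..d}. \<Sum>a<n. 2 * card {u \<in> hypergrid n d. shift i a u \<in> hypergrid n d \<and> f u = 1 \<and> f (shift i a u) = 0})"
      by (intro sum_mono card_bit_pairs_le)
    also have "\<dots> \<le> 2 * card (negative_edges n d f)"
      using sum_card_shift_edges_le[of n d f] by (simp add: sum_distrib_left[symmetric])
    finally show ?thesis .
  qed
  ultimately show thesis by (rule that)
qed

text \<open>The constant is a product of two halves: one from two matched pairs per negative edge
  and bit, one from two endpoints per matched pair.\<close>

lemma negative_influence_ge:
  assumes n: "n > 0" and f: "f \<in> hypergrid n d \<rightarrow> {0, 1}"
    and \<epsilon>: "\<epsilon> > 0" and far: "eps_far_from_monotone n d \<epsilon> f"
  shows "negative_influence n d f \<ge> 1 / 4 * min_average_dist n d f * \<epsilon>"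
proof -
  obtain M where M: "maximal_violation_matching n d f M"
    and short: "(\<Sum>(x, y)\<in>M. bit_dist d x y) \<le> 2 * card (negative_edges n d f)"
    using ex_maximal_matching_short[OF f] .
  have ME: "M \<subseteq> violated_pairs n d f"
    using M unfolding maximal_violation_matching_def violation_matching_def by simp
  have N: "real n ^ d > 0" using n by simp
  have card: "\<epsilon> * real n ^ d \<le> 2 * real (card M)"
    using card_maximal_matching_ge[OF f far M] .
  \<comment> \<open>Positivity of \<open>\<epsilon>\<close> makes \<open>M\<close> nonempty, so its
    average distance is a genuine quotient.\<close>
  then have cM: "real (card M) > 0" using mult_pos_pos[OF \<epsilon> N] by linarith
  define D where "D = (\<Sum>(x, y)\<in>M. real (augmented_dist n d x y))"
  have D0: "D \<ge> 0" unfolding D_def by (intro sum_nonneg) auto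
  have "D \<le> (\<Sum>(x, y)\<in>M. real (bit_dist d x y))"
    unfolding D_def
  proof (rule sum_mono)
    fix e assume "e \<in> M"
    then obtain x y where e: "e = (x, y)" "(x, y) \<in> violated_pairs n d f" using ME by (cases e) auto
    then show "(case e of (x, y) \<Rightarrow> real (augmented_dist n d x y)) \<le> (case e of (x, y) \<Rightarrow> real (bit_dist d x y))"
      using augmented_dist_le_bit_dist violated_pairsD(1-3)[OF e(2)] by simp
  qed
  also have "\<dots> = real (\<Sum>(x, y)\<in>M. bit_dist d x y)" by (simp add: case_prod_unfold)
  also have "\<dots> \<le> 2 * real (card (negative_edges n d f))" using short by linarith
  finally have DS: "D \<le> 2 * real (card (negative_edges n d f))" .
  have "finite {M. maximal_violation_matching n d f M}"
    by (rule finite_subset[of _ "Pow (violated_pairs n d f)"])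
      (auto simp: maximal_violation_matching_def violation_matching_def finite_violated_pairs)
  then have "min_average_dist n d f \<le> average_dist n d M"
    unfolding min_average_dist_def using M by (intro Min_le) auto
  then have "min_average_dist n d f \<le> D / real (card M)"
    unfolding average_dist_def D_def .
  then have "1 / 4 * min_average_dist n d f * \<epsilon> \<le> 1 / 4 * (D / real (card M)) * \<epsilon>"
    using \<epsilon> by (intro mult_right_mono mult_left_mono) auto
  \<comment> \<open>Replacing \<open>\<epsilon>\<close> by its upper bound in terms of
    \<open>card M\<close> lets the size of the matching cancel.\<close>
  also have "\<dots> \<le> 1 / 4 * (D / real (card M)) * (2 * real (card M) / real n ^ d)"
    using card N D0 cM by (intro mult_left_mono) (simp_all add: field_simps)
  also have "\<dots> = D / 2 / real n ^ d" using cM by simp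
  also have "\<dots> \<le> negative_influence n d f"
    unfolding negative_influence_def using DS N by (intro divide_right_mono) simp_all
  finally show ?thesis .
qed

theorem theorem2p2:
  shows "\<exists>c::real. c > 0 \<and>
    (\<forall>(n::nat) (d::nat) (f :: (nat \<Rightarrow> nat) \<Rightarrow> nat) (\<epsilon>::real).
       (\<exists>k::nat. n = 2 ^ k) \<longrightarrow>
       f \<in> hypergrid n d \<rightarrow> {0, 1} \<longrightarrow>
       \<epsilon> > 0 \<longrightarrow>
       eps_far_from_monotone n d \<epsilon> f \<longrightarrow>
       negative_influence n d f \<ge> c * min_average_dist n d f * \<epsilon>)"
proof (intro exI[of _ "1 / 4"] conjI allI impI)
  fix n d :: nat and f :: "(nat \<Rightarrow> nat) \<Rightarrow> nat" and \<epsilon> :: real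
  assume "\<exists>k::nat. n = 2 ^ k" "f \<in> hypergrid n d \<rightarrow> {0, 1}" "\<epsilon> > 0" "eps_far_from_monotone n d \<epsilon> f"
  then show "1 / 4 * min_average_dist n d f * \<epsilon> \<le> negative_influence n d f"
    by (intro negative_influence_ge) auto
qed simp

end
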